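(* The nonexistence of self-similar blowing up solutions of the 3D incompressible Euler equations implies the nonexistence of locally self-similar blowing up solutions of the 3D incompressible Euler equations.
   Context: The Euler equations (E) for homogeneous incompressible fluid flows on $\mathbb{R}^3$ are $$\frac{\partial v}{\partial t}+(v\cdot\nabla)v=-\nabla p,\qquad \operatorname{div} v=0,\qquad (x,t)\in\mathbb{R}^3\times(0,\infty),$$ $$v(x,0)=v_0(x),\qquad x\in\mathbb{R}^3,$$ where $v=(v_1,v_2,v_3)$, $v_j=v_j(x,t)$, $j=1,2,3$, is the velocity of the flow, $p=p(x,t)$ is the scalar pressure, and $v_0$ is the given initial velocity, satisfying $\operatorname{div} v_0=0$. A vector field $V$ is solenoidal if $\operatorname{div} V=0$. Self-similar blowing up solution: a solution $v(x,t)$ of (E) is called a self-similar blowing up solution if there exist $\alpha>-1$, $T_*>0$ and a solenoidal vector field $V$ defined on $\mathbb{R}^3$ such that $$v(x,t)=\frac{1}{(T_*-t)^{\frac{\alpha}{\alpha+1}}}\,V\!\left(\frac{x}{(T_*-t)^{\frac{1}{\alpha+1}}}\right)\qquad\text{for all }(x,t)\in\mathbb{R}^3\times(-\infty,T_* ).$$ Locally self-similar blowing up solution: a solution $v(x,t)$ of (E) is called a locally self-similar blowing up solution near a space-time point $(x_*,T_* )\in\mathbb{R}^3\times(-\infty,+\infty)$ if there exist $r>0$, $\alpha>-1$ and a solenoidal vector field $V$ defined on $\mathbb{R}^3$ such that the representation $$v(x,t)=\frac{1}{(T_*-t)^{\frac{\alpha}{\alpha+1}}}\,V\!\left(\frac{x-x_*}{(T_*-t)^{\frac{1}{\alpha+1}}}\right)\qquad\text{for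 all }(x,t)\in B(x_*,r)\times(T_*-r^{\alpha+1},T_* )$$ holds true, where $B(x_*,r)=\{x\in\mathbb{R}^3 : |x-x_*|<r\}$. *)

theory Defs
  imports "HOL-Analysis.Analysis"
begin

definition partial_deriv ::
    "3 \<Rightarrow> (real^3 \<Rightarrow> 'b::real_normed_vector) \<Rightarrow> real^3 \<Rightarrow> 'b" where
  "partial_deriv j f x = frechet_derivative f (at x) (axis j 1)"

definition divergence :: "(real^3 \<Rightarrow> real^3) \<Rightarrow> real^3 \<Rightarrow> real" where
  "divergence V x = (\<Sum>j\<in>UNIV. partial_deriv j V x $ j)"

definition gradient :: "(real^3 \<Rightarrow> real) \<Rightarrow> real^3 \<Rightarrow> real^3" where
  "gradient f x = (\<chi> j. partial_deriv j f x)"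

definition advection :: "(real^3 \<Rightarrow> real^3) \<Rightarrow> (real^3 \<Rightarrow> real^3) \<Rightarrow> real^3 \<Rightarrow> real^3" where
  "advection u w x = (\<Sum>j\<in>UNIV. (u x $ j) *\<^sub>R partial_deriv j w x)"

text \<open>Differentiability is explicit because \<^const>\<open>frechet_derivative\<close> is unspecified at
  points of non-differentiability.\<close>

definition solenoidal :: "(real^3 \<Rightarrow> real^3) \<Rightarrow> bool" where
  "solenoidal V \<longleftrightarrow> (\<forall>x. V differentiable (at x) \<and> divergence V x = 0)"

text \<open>Classical solutions of the Euler equations on \<open>\<real>\<^sup>3 \<times> I\<close>, for an open time interval \<open>I\<close>:
  the velocity is continuously differentiable in space-time. Only the spatial gradient of the
  pressure enters the equations, and the pressure is determined up to a function of time, so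
  nothing is required of its dependence on time. No decay at spatial infinity is imposed.
  There is no separate initial datum: the values of the solution at the initial time define it.\<close>

definition euler_solution :: "real set \<Rightarrow> (real^3 \<Rightarrow> real \<Rightarrow> real^3) \<Rightarrow> bool" where
  "euler_solution I v \<longleftrightarrow>
     (\<exists>v' :: (real^3) \<times> real \<Rightarrow> ((real^3) \<times> real) \<Rightarrow>\<^sub>L (real^3).
        (\<forall>z \<in> UNIV \<times> I. ((\<lambda>(x, t). v x t) has_derivative blinfun_apply (v' z)) (at z)) \<and>
        continuous_on (UNIV \<times> I) v') \<and>
     (\<exists>p :: real^3 \<Rightarrow> real \<Rightarrow> real. \<forall>x. \<forall>t\<in>I.
        (\<lambda>y. p y t) differentiable (at x) \<and>
        vector_derivative (\<lambda>s. v x s) (at t) + advection (\<lambda>y. v y t) (\<lambda>y. v y t) x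
          = - gradient (\<lambda>y. p y t) x \<and>
        divergence (\<lambda>y. v y t) x = 0)"

text \<open>The parameter \<open>\<P>\<close> is a class of admissible exponents and profiles \<open>(\<alpha>, V)\<close>;
  \<open>\<P> = UNIV\<close> imposes no restriction. Without a restriction, self-similar solutions do exist:
  \<open>V = 0\<close>, constant \<open>V\<close> with \<open>\<alpha> = 0\<close>, or \<open>V y = A y\<close> with \<open>A\<close> symmetric and
  trace-free, which gives \<open>v x t = A x / (T - t)\<close>.\<close>

definition self_similar_blowup ::
    "(real \<times> (real^3 \<Rightarrow> real^3)) set \<Rightarrow> (real^3 \<Rightarrow> real \<Rightarrow> real^3) \<Rightarrow> bool" where
  "self_similar_blowup \<P> v \<longleftrightarrow>
     (\<exists>\<alpha> T V. \<alpha> > -1 \<and> T > 0 \<and> solenoidal V \<and> (\<alpha>, V) \<in> \<P> \<and>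
        euler_solution {..<T} v \<and>
        (\<forall>x. \<forall>t<T.
           v x t = (1 / (T - t) powr (\<alpha> / (\<alpha> + 1))) *\<^sub>R
                     V ((1 / (T - t) powr (1 / (\<alpha> + 1))) *\<^sub>R x)))"

text \<open>The equations are required on all of space, but only for the times at which the
  representation is asserted; a solution on any larger time interval restricts to this one.\<close>

definition locally_self_similar_blowup ::
    "(real \<times> (real^3 \<Rightarrow> real^3)) set \<Rightarrow> (real^3 \<Rightarrow> real \<Rightarrow> real^3) \<Rightarrow> real^3 \<Rightarrow> real \<Rightarrow> bool" where
  "locally_self_similar_blowup \<P> v x\<^sub>0 T \<longleftrightarrow>
     (\<exists>r \<alpha> V. r > 0 \<and> \<alpha> > -1 \<and> solenoidal V \<and> (\<alpha>, V) \<in> \<P> \<and>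
        euler_solution {T - r powr (\<alpha> + 1)<..<T} v \<and>
        (\<forall>x \<in> ball x\<^sub>0 r. \<forall>t \<in> {T - r powr (\<alpha> + 1)<..<T}.
           v x t = (1 / (T - t) powr (\<alpha> / (\<alpha> + 1))) *\<^sub>R
                     V ((1 / (T - t) powr (1 / (\<alpha> + 1))) *\<^sub>R (x - x\<^sub>0))))"

end

theory Submission
  imports Defs
begin

text \<open>
  A locally self-similar flow already carries a global one. As \<open>t\<close> tends to \<open>T\<close>, the ball of
  radius \<open>r\<close> about the blow-up point, seen in the similarity variable
  \<open>y = (x - x\<^sub>0) / (T - t) powr (1 / (\<alpha> + 1))\<close>, fills the whole space, so the local representation
  determines the profile \<open>V\<close> everywhere. The candidate for a global solution is the flow \<open>w\<close> with
  this same exponent and profile, blowing up at the origin at time \<open>1\<close>; what has to be seen is that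
  \<open>w\<close> solves the Euler equations on all of space and for all times before \<open>1\<close>.

  The equations are invariant under the scaling that fits the exponent \<open>\<alpha>\<close>: for each \<open>\<mu> > 0\<close>
  the zoomed flow
  \<open>u x t = \<mu> powr \<alpha> *\<^sub>R v (x\<^sub>0 + \<mu> *\<^sub>R x) (T - \<mu> powr (\<alpha> + 1) * (1 - t))\<close>
  is again a solution (\<open>euler_solution_rescale\<close>). Self-similarity of \<open>w\<close>
  (\<open>self_similar_rescale\<close>) says that \<open>u\<close> coincides with \<open>w\<close> as long as the argument of \<open>v\<close> stays
  in the region of the local representation, that is, for \<open>norm x < r / \<mu>\<close> and
  \<open>1 - t < (r / \<mu>) powr (\<alpha> + 1)\<close>. As \<open>\<mu>\<close> tends to \<open>0\<close> these regions exhaust the domain of \<open>w\<close>.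

  It remains to pass from solutions agreeing with \<open>w\<close> on larger and larger regions to \<open>w\<close> itself
  (\<open>euler_solution_exhaustion\<close>). Regularity and the incompressibility condition are local. The
  pressure is the one global object: the pressures of the zoomed flows are different functions, but
  at a fixed time their gradients are all prescribed by \<open>w\<close>, so on balls they differ by constants
  and can be glued once normalised to vanish at the origin (\<open>primitive_from_balls\<close>).
\<close>

section \<open>Spatial derivatives\<close>

lemma partial_deriv_eq:
  assumes "(f has_derivative f') (at x)"
  shows "partial_deriv j f x = f' (axis j 1)"
  using frechet_derivative_at[OF assms] by (simp add: partial_deriv_def)

text \<open>Both sides choose from the same set of derivatives, so they agree even where that set is empty. This lets equations for one flow be transferred to another
  that coincides with it on an open set without first discussing the regularity of either.\<close>

lemma partial_deriv_cong_germ: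
  assumes "open S" "x \<in> S" "\<And>y. y \<in> S \<Longrightarrow> f y = g y"
  shows "partial_deriv j f x = partial_deriv j g x"
proof -
  have "(f has_derivative D) (at x) \<longleftrightarrow> (g has_derivative D) (at x)" for D
    using has_derivative_transform_within_open[OF _ assms(1,2), of f D UNIV g]
      has_derivative_transform_within_open[OF _ assms(1,2), of g D UNIV f] assms(3) by auto
  then show ?thesis by (simp add: partial_deriv_def frechet_derivative_def)
qed

lemma partial_deriv_affine:
  assumes "f differentiable (at (x0 + b *\<^sub>R x))"
  shows "partial_deriv j (\<lambda>y. a *\<^sub>R f (x0 + b *\<^sub>R y)) x
           = (a * b) *\<^sub>R partial_deriv j f (x0 + b *\<^sub>R x)"
    and "(\<lambda>y. a *\<^sub>R f (x0 + b *\<^sub>R y)) differentiable (at x)"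
proof -
  obtain f' where f': "(f has_derivative f') (at (x0 + b *\<^sub>R x))"
    using assms by (auto simp: differentiable_def)
  have "((\<lambda>y. x0 + b *\<^sub>R y) has_derivative (\<lambda>h. b *\<^sub>R h)) (at x)"
    by (auto intro!: derivative_eq_intros)
  from has_derivative_compose[OF this f']
  have d: "((\<lambda>y. a *\<^sub>R f (x0 + b *\<^sub>R y)) has_derivative (\<lambda>h. a *\<^sub>R f' (b *\<^sub>R h))) (at x)"
    by (rule has_derivative_scaleR_right)
  show "partial_deriv j (\<lambda>y. a *\<^sub>R f (x0 + b *\<^sub>R y)) x
           = (a * b) *\<^sub>R partial_deriv j f (x0 + b *\<^sub>R x)"
    using linear_scale[OF has_derivative_linear[OF f']]
    by (simp add: partial_deriv_eq[OF d] partial_deriv_eq[OF f'])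
  show "(\<lambda>y. a *\<^sub>R f (x0 + b *\<^sub>R y)) differentiable (at x)"
    using d by (auto simp: differentiable_def)
qed

lemma has_derivative_gradient:
  fixes f :: "real^3 \<Rightarrow> real"
  assumes "f differentiable (at x)"
  shows "(f has_derivative (\<lambda>h. gradient f x \<bullet> h)) (at x)"
proof -
  obtain f' where f': "(f has_derivative f') (at x)"
    using assms by (auto simp: differentiable_def)
  have "f' h = gradient f x \<bullet> h" for h
  proof -
    have "f' h = f' (\<Sum>j\<in>UNIV. h $ j *\<^sub>R axis j 1)"
      using basis_expansion[of h] by (simp add: scalar_mult_eq_scaleR)
    also have "\<dots> = (\<Sum>j\<in>UNIV. h $ j *\<^sub>R f' (axis j 1))"
      by (simp add: linear_sum[OF has_derivative_linear[OF f']]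
          linear_scale[OF has_derivative_linear[OF f']])
    also have "\<dots> = gradient f x \<bullet> h"
      by (simp add: gradient_def partial_deriv_eq[OF f'] inner_vec_def mult.commute)
    finally show ?thesis .
  qed
  then have "f' = (\<lambda>h. gradient f x \<bullet> h)" by auto
  then show ?thesis using f' by simp
qed

lemma gradient_eq:
  assumes "(f has_derivative (\<lambda>h. g \<bullet> h)) (at x)"
  shows "gradient f x = g"
  by (simp add: gradient_def partial_deriv_eq[OF assms] inner_axis vec_eq_iff)

text \<open>The equations are stated with separate space and time derivatives, while the regularity
  assumed of a solution is joint; the slices are compositions with the two affine inclusions.\<close>

lemma slices_of_spacetime_derivative:
  assumes "((\<lambda>(x, t). v x t) has_derivative D) (at (x, t))"
  shows "(\<lambda>y. v y t) differentiable (at x)"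
    and "(\<lambda>s. v x s) differentiable (at t)"
proof -
  have "((\<lambda>y. (y, t)) has_derivative (\<lambda>h. (h, 0))) (at x)"
    "((\<lambda>s. (x, s)) has_derivative (\<lambda>h. (0, h))) (at t)"
    by (auto intro!: derivative_eq_intros)
  from this[THEN has_derivative_compose, OF assms]
  show "(\<lambda>y. v y t) differentiable (at x)" "(\<lambda>s. v x s) differentiable (at t)"
    by (auto simp: differentiable_def)
qed

section \<open>Scaling invariance\<close>

text \<open>Scaling velocity by \<open>a\<close> and length by \<open>b\<close> forces time to scale by \<open>a * b\<close>: then the
  acceleration and the advection term both pick up the factor \<open>a\<^sup>2 * b\<close>, and so does the
  gradient of the pressure \<open>a\<^sup>2 * p\<close>. The two factors remain independent, which is why
  self-similar flows are conceivable for a whole family of exponents \<open>\<alpha>\<close>.\<close>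

lemma euler_solution_rescale:
  fixes v :: "real^3 \<Rightarrow> real \<Rightarrow> real^3"
  assumes sol: "euler_solution I v" and J: "\<And>t. t \<in> J \<Longrightarrow> s0 + (a * b) * t \<in> I"
  shows "euler_solution J (\<lambda>x t. a *\<^sub>R v (x0 + b *\<^sub>R x) (s0 + (a * b) * t))"
proof -
  define \<phi> where "\<phi> = (\<lambda>z :: (real^3) \<times> real. (x0 + b *\<^sub>R fst z, s0 + (a * b) * snd z))"
  define L where "L = (\<lambda>z :: (real^3) \<times> real. (b *\<^sub>R fst z, (a * b) * snd z))"
  obtain v' where
    v': "\<And>z. z \<in> UNIV \<times> I \<Longrightarrow>
           ((\<lambda>(x, t). v x t) has_derivative blinfun_apply (v' z)) (at z)"
    and cont: "continuous_on (UNIV \<times> I) v'"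
    using sol unfolding euler_solution_def by blast
  obtain p where
    p: "\<And>x t. t \<in> I \<Longrightarrow> (\<lambda>y. p y t) differentiable (at x)"
    and eq: "\<And>x t. t \<in> I \<Longrightarrow> vector_derivative (\<lambda>s. v x s) (at t)
          + advection (\<lambda>y. v y t) (\<lambda>y. v y t) x = - gradient (\<lambda>y. p y t) x"
    and div0: "\<And>x t. t \<in> I \<Longrightarrow> divergence (\<lambda>y. v y t) x = 0"
    using sol unfolding euler_solution_def by blast
  have \<phi>_in: "\<phi> z \<in> UNIV \<times> I" if "z \<in> UNIV \<times> J" for z
    using that J by (auto simp: \<phi>_def)
  have \<phi>': "(\<phi> has_derivative L) (at z)" for z
    unfolding \<phi>_def L_def by (auto intro!: derivative_eq_intros)
  then have "bounded_linear L" by (rule has_derivative_bounded_linear)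
  then obtain LL where LL: "blinfun_apply LL = L"
    using bounded_linear_Blinfun_apply by blast
  have "continuous_on S \<phi>" for S
    unfolding \<phi>_def by (intro continuous_intros)
  then have "continuous_on (UNIV \<times> J) (\<lambda>z. v' (\<phi> z))"
    using continuous_on_compose2[OF cont] \<phi>_in by blast
  then have C: "continuous_on (UNIV \<times> J) (\<lambda>z. a *\<^sub>R (v' (\<phi> z) o\<^sub>L LL))"
    by (intro continuous_intros)
  have D: "((\<lambda>(x, t). a *\<^sub>R v (x0 + b *\<^sub>R x) (s0 + (a * b) * t)) has_derivative
          blinfun_apply (a *\<^sub>R (v' (\<phi> z) o\<^sub>L LL))) (at z)" if "z \<in> UNIV \<times> J" for z
  proof -
    have "((\<lambda>z. a *\<^sub>R (case \<phi> z of (x, t) \<Rightarrow> v x t)) has_derivative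
        (\<lambda>h. a *\<^sub>R v' (\<phi> z) (L h))) (at z)"
      by (intro has_derivative_scaleR_right has_derivative_compose[OF \<phi>' v'[OF \<phi>_in[OF that]]])
    moreover have "blinfun_apply (a *\<^sub>R (v' (\<phi> z) o\<^sub>L LL)) = (\<lambda>h. a *\<^sub>R v' (\<phi> z) (L h))"
      by (auto simp: scaleR_blinfun.rep_eq LL)
    ultimately show ?thesis by (simp add: \<phi>_def case_prod_unfold)
  qed
  define q where "q = (\<lambda>x t. a\<^sup>2 *\<^sub>R p (x0 + b *\<^sub>R x) (s0 + (a * b) * t))"
  have "(\<lambda>y. q y t) differentiable (at x) \<and>
        vector_derivative (\<lambda>s. a *\<^sub>R v (x0 + b *\<^sub>R x) (s0 + (a * b) * s)) (at t)
        + advection (\<lambda>y. a *\<^sub>R v (x0 + b *\<^sub>R y) (s0 + (a * b) * t))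
            (\<lambda>y. a *\<^sub>R v (x0 + b *\<^sub>R y) (s0 + (a * b) * t)) x = - gradient (\<lambda>y. q y t) x \<and>
        divergence (\<lambda>y. a *\<^sub>R v (x0 + b *\<^sub>R y) (s0 + (a * b) * t)) x = 0" if "t \<in> J" for x t
  proof -
    define \<sigma> X where "\<sigma> = s0 + (a * b) * t" and "X = x0 + b *\<^sub>R x"
    have \<sigma>: "\<sigma> \<in> I" using J that by (simp add: \<sigma>_def)
    then have "((\<lambda>(x, t). v x t) has_derivative blinfun_apply (v' (X, \<sigma>))) (at (X, \<sigma>))"
      using v' by simp
    from slices_of_spacetime_derivative[OF this]
    have space: "(\<lambda>y. v y \<sigma>) differentiable (at (x0 + b *\<^sub>R x))"
      and time: "(\<lambda>s. v X s) differentiable (at \<sigma>)" by (auto simp: X_def)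
    have "((\<lambda>s. s0 + (a * b) * s) has_vector_derivative a * b) (at t)"
      by (auto intro!: derivative_eq_intros)
    from vector_diff_chain_at[OF this, of "v X"] time
    have "((\<lambda>s. v X (s0 + (a * b) * s)) has_vector_derivative
        (a * b) *\<^sub>R vector_derivative (v X) (at \<sigma>)) (at t)"
      by (simp add: vector_derivative_works \<sigma>_def o_def)
    from has_vector_derivative_scaleR[OF DERIV_const[of a] this]
    have vd: "vector_derivative (\<lambda>s. a *\<^sub>R v X (s0 + (a * b) * s)) (at t)
        = (a\<^sup>2 * b) *\<^sub>R vector_derivative (v X) (at \<sigma>)"
      by (intro vector_derivative_at) (simp add: power2_eq_square mult_ac)
    have adv: "advection (\<lambda>y. a *\<^sub>R v (x0 + b *\<^sub>R y) \<sigma>) (\<lambda>y. a *\<^sub>R v (x0 + b *\<^sub>R y) \<sigma>) x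
        = (a\<^sup>2 * b) *\<^sub>R advection (\<lambda>y. v y \<sigma>) (\<lambda>y. v y \<sigma>) X"
      unfolding advection_def partial_deriv_affine(1)[OF space]
      by (simp add: scaleR_sum_right power2_eq_square X_def mult_ac)
    have grad: "gradient (\<lambda>y. a\<^sup>2 *\<^sub>R p (x0 + b *\<^sub>R y) \<sigma>) x
        = (a\<^sup>2 * b) *\<^sub>R gradient (\<lambda>y. p y \<sigma>) X"
      unfolding gradient_def partial_deriv_affine(1)[OF p[OF \<sigma>]]
      by (simp add: vec_eq_iff X_def)
    have "divergence (\<lambda>y. a *\<^sub>R v (x0 + b *\<^sub>R y) \<sigma>) x = (a * b) * divergence (\<lambda>y. v y \<sigma>) X"
      unfolding divergence_def partial_deriv_affine(1)[OF space]
      by (simp add: sum_distrib_left X_def)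
    then have dv: "divergence (\<lambda>y. a *\<^sub>R v (x0 + b *\<^sub>R y) \<sigma>) x = 0"
      using div0[OF \<sigma>] by simp
    have "(\<lambda>y. q y t) differentiable (at x)"
      unfolding q_def by (rule partial_deriv_affine(2)) (use p[OF \<sigma>] in \<open>simp add: \<sigma>_def\<close>)
    moreover have "(a\<^sup>2 * b) *\<^sub>R vector_derivative (v X) (at \<sigma>)
        + (a\<^sup>2 * b) *\<^sub>R advection (\<lambda>y. v y \<sigma>) (\<lambda>y. v y \<sigma>) X
        = - ((a\<^sup>2 * b) *\<^sub>R gradient (\<lambda>y. p y \<sigma>) X)"
      using arg_cong[OF eq[OF \<sigma>, of X], of "scaleR (a\<^sup>2 * b)"]
      by (simp only: scaleR_add_right scaleR_minus_right)
    ultimately show ?thesis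
      using vd adv grad dv by (simp add: q_def flip: \<sigma>_def X_def)
  qed
  with C D show ?thesis
    unfolding euler_solution_def
    by (intro conjI exI[of _ "\<lambda>z. a *\<^sub>R (v' (\<phi> z) o\<^sub>L LL)"] exI[of _ q]) blast+
qed

section \<open>Passing from balls to the whole space\<close>

text \<open>Two primitives on a common ball about the origin have a difference with zero derivative, hence
  a constant difference. Subtracting the value at the origin makes them agree, so the value at a
  point may be read off from any ball that contains it.\<close>

lemma primitive_from_balls:
  fixes f' :: "'a::real_normed_vector \<Rightarrow> 'a \<Rightarrow> 'b::real_normed_vector"
  assumes "\<And>R. \<exists>q. \<forall>x\<in>ball 0 R. (q has_derivative f' x) (at x)"
  shows "\<exists>P. \<forall>x. (P has_derivative f' x) (at x)"
proof -
  obtain q where q: "\<And>R x. x \<in> ball 0 R \<Longrightarrow> (q R has_derivative f' x) (at x)"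
    using assms by metis
  \<comment> \<open>Any radius above \<open>norm x\<close> would do; fixing one as a function of \<open>x\<close> makes \<open>P\<close> a function.\<close>
  define P where "P = (\<lambda>x. q (norm x + 1) x - q (norm x + 1) 0)"
  have P: "P y = q R y - q R 0" if y: "y \<in> ball 0 R" for y R
  proof -
    let ?R = "norm y + 1"
    let ?B = "ball 0 (min R ?R) :: 'a set"
    have "((\<lambda>x. q ?R x - q R x) has_derivative (\<lambda>h. 0)) (at x within ?B)" if "x \<in> ?B" for x
      using has_derivative_diff[OF q[of x ?R] q[of x R]] that
      by (auto intro: has_derivative_at_withinI)
    then have "q ?R y - q R y = q ?R 0 - q R 0"
      by (rule has_derivative_zero_unique[OF convex_ball])
        (use y in \<open>auto intro: le_less_trans[OF norm_ge_zero] add_nonneg_pos\<close>)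
    then show ?thesis by (simp add: P_def algebra_simps)
  qed
  have "(P has_derivative f' x) (at x)" for x
  proof (rule has_derivative_transform_within_open)
    show "((\<lambda>y. q (norm x + 1) y - q (norm x + 1) 0) has_derivative f' x) (at x)"
      using has_derivative_diff[OF q[of x "norm x + 1"] has_derivative_const] by simp
    show "x \<in> ball 0 (norm x + 1)" by simp
  qed (auto simp: P)
  then show ?thesis by blast
qed

text \<open>The flow \<open>w\<close> prescribes the derivatives of velocity and hence, through the momentum equation,
  the gradient of each local pressure. This makes the pressures compatible up to constants. Since
  the pressure enters only through its gradient at each fixed time, the gluing is done in space,
  one time after another.\<close>

lemma euler_solution_exhaustion:
  fixes w :: "real^3 \<Rightarrow> real \<Rightarrow> real^3"
  assumes loc: "\<And>R t. t \<in> I \<Longrightarrow> \<exists>u J. open J \<and> t \<in> J \<and> euler_solution J u \<and>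
                  (\<forall>x\<in>ball 0 R. \<forall>s\<in>J. u x s = w x s)"
  shows "euler_solution I w"
proof -
  let ?w = "\<lambda>(x, t). w x t"
  \<comment> \<open>The derivative of \<open>w\<close> must be a single function on space-time whose continuity can be tested
    locally; uniqueness of derivatives identifies it near each point with that of some \<open>u\<close>.\<close>
  define w' where "w' = (\<lambda>z. Blinfun (frechet_derivative ?w (at z)))"
  have w'_eq: "w' z = D" if "(?w has_derivative blinfun_apply D) (at z)" for z D
    using frechet_derivative_at[OF that] by (metis blinfun_apply_inverse w'_def)
  have near: "(?w has_derivative blinfun_apply (w' z)) (at z) \<and> isCont w' z"
    if z: "z \<in> UNIV \<times> I" for z
  proof -
    obtain x t where xt: "z = (x, t)" "t \<in> I" using z by auto
    obtain u J where J: "open J" "t \<in> J" and u: "euler_solution J u"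
      and eq: "\<forall>y\<in>ball 0 (norm x + 1). \<forall>s\<in>J. u y s = w y s"
      using loc[OF xt(2)] by blast
    obtain u' where u': "\<And>\<zeta>. \<zeta> \<in> UNIV \<times> J \<Longrightarrow>
          ((\<lambda>(x, t). u x t) has_derivative blinfun_apply (u' \<zeta>)) (at \<zeta>)"
      and cont: "continuous_on (UNIV \<times> J) u'"
      using u unfolding euler_solution_def by metis
    let ?S = "ball 0 (norm x + 1) \<times> J"
    have S: "open ?S" "z \<in> ?S" using J xt by (auto intro: open_Times)
    have D: "(?w has_derivative blinfun_apply (u' \<zeta>)) (at \<zeta>)" if "\<zeta> \<in> ?S" for \<zeta>
      by (rule has_derivative_transform_within_open[OF u' S(1) that]) (use that eq in auto)
    then have E: "w' \<zeta> = u' \<zeta>" if "\<zeta> \<in> ?S" for \<zeta> using that w'_eq by blast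
    have "continuous_on ?S u'" by (rule continuous_on_subset[OF cont]) auto
    then have "continuous_on ?S w'" using E by (simp cong: continuous_on_cong)
    then have "isCont w' z" using continuous_on_eq_continuous_at[OF S(1)] S(2) by blast
    then show ?thesis using D[OF S(2)] E[OF S(2)] by simp
  qed
  have C: "continuous_on (UNIV \<times> I) w'"
    using near by (blast intro: continuous_at_imp_continuous_on)
  \<comment> \<open>The negative pressure gradient that the momentum equation demands of \<open>w\<close>.\<close>
  define F where "F = (\<lambda>t x. vector_derivative (\<lambda>s. w x s) (at t)
      + advection (\<lambda>y. w y t) (\<lambda>y. w y t) x)"
  have balls: "\<exists>q. \<forall>x\<in>ball 0 R. (q has_derivative (\<lambda>h. - F t x \<bullet> h)) (at x) \<and>
      divergence (\<lambda>y. w y t) x = 0" if t: "t \<in> I" for t R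
  proof -
    obtain u J where J: "open J" "t \<in> J" and u: "euler_solution J u"
      and eq: "\<forall>y\<in>ball 0 R. \<forall>s\<in>J. u y s = w y s"
      using loc[OF t] by blast
    then obtain p where p: "\<And>x. (\<lambda>y. p y t) differentiable (at x)"
      and pde: "\<And>x. vector_derivative (\<lambda>s. u x s) (at t)
          + advection (\<lambda>y. u y t) (\<lambda>y. u y t) x = - gradient (\<lambda>y. p y t) x"
      and div0: "\<And>x. divergence (\<lambda>y. u y t) x = 0"
      unfolding euler_solution_def by metis
    have "((\<lambda>y. p y t) has_derivative (\<lambda>h. - F t x \<bullet> h)) (at x) \<and>
        divergence (\<lambda>y. w y t) x = 0" if x: "x \<in> ball 0 R" for x
    proof -
      have pd: "partial_deriv j (\<lambda>y. w y t) x = partial_deriv j (\<lambda>y. u y t) x" for j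
        by (rule partial_deriv_cong_germ[OF open_ball x]) (use eq J in auto)
      have "(w x has_vector_derivative D) (at t) \<longleftrightarrow> (u x has_vector_derivative D) (at t)" for D
        using has_vector_derivative_transform_within_open[OF _ J, of "w x" D "u x"]
          has_vector_derivative_transform_within_open[OF _ J, of "u x" D "w x"] eq x by auto
      then have "vector_derivative (w x) (at t) = vector_derivative (u x) (at t)"
        by (simp add: vector_derivative_def)
      then have "- F t x = gradient (\<lambda>y. p y t) x"
        using pde[of x] eq x J by (simp add: F_def advection_def pd)
      then show ?thesis
        using has_derivative_gradient[OF p] div0[of x] by (simp add: divergence_def pd)
    qed
    then show ?thesis by blast
  qed
  have "\<exists>P. \<forall>x. (P has_derivative (\<lambda>h. - F t x \<bullet> h)) (at x)" if "t \<in> I" for t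
    by (rule primitive_from_balls) (use balls[OF that] in blast)
  then obtain P where P: "\<And>t x. t \<in> I \<Longrightarrow> (P t has_derivative (\<lambda>h. - F t x \<bullet> h)) (at x)"
    by metis
  have div0: "divergence (\<lambda>y. w y t) x = 0" if "t \<in> I" for t x
    using balls[OF that, of "norm x + 1"] by auto
  have "P t differentiable (at x) \<and> F t x = - gradient (P t) x" if "t \<in> I" for t x
    using P[OF that, of x] gradient_eq[OF P[OF that, of x]] by (auto simp: differentiable_def)
  then show ?thesis
    unfolding euler_solution_def F_def using near C div0
    by (intro conjI exI[of _ w'] exI[of _ "\<lambda>x t. P t x"]) auto
qed

section \<open>From local to global self-similarity\<close>

text \<open>Self-similarity as invariance: with \<open>\<tau>\<close> the time left before blow-up, replacing \<open>(x, \<tau>)\<close> by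
  \<open>(\<mu> x, \<mu> powr (\<alpha> + 1) * \<tau>)\<close> leaves the similarity variable unchanged and divides the amplitude
  by \<open>\<mu> powr \<alpha>\<close>.\<close>

lemma self_similar_rescale:
  fixes V :: "real^3 \<Rightarrow> real^3"
  assumes "\<alpha> > -1" "\<mu> > 0" "\<tau> > 0"
  shows "\<mu> powr \<alpha> *\<^sub>R ((1 / (\<mu> powr (\<alpha> + 1) * \<tau>) powr (\<alpha> / (\<alpha> + 1))) *\<^sub>R
           V ((1 / (\<mu> powr (\<alpha> + 1) * \<tau>) powr (1 / (\<alpha> + 1))) *\<^sub>R (\<mu> *\<^sub>R x)))
         = (1 / \<tau> powr (\<alpha> / (\<alpha> + 1))) *\<^sub>R V ((1 / \<tau> powr (1 / (\<alpha> + 1))) *\<^sub>R x)"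
  using assms by (simp add: powr_mult powr_powr)

theorem theorem1:
  fixes \<P> :: "(real \<times> (real^3 \<Rightarrow> real^3)) set"
  assumes "\<not> (\<exists>v. self_similar_blowup \<P> v)"
  shows "\<not> (\<exists>v x\<^sub>0 T. locally_self_similar_blowup \<P> v x\<^sub>0 T)"
proof
  assume "\<exists>v x\<^sub>0 T. locally_self_similar_blowup \<P> v x\<^sub>0 T"
  then obtain v x\<^sub>0 T r \<alpha> V where r: "r > 0" and \<alpha>: "\<alpha> > -1" and V: "solenoidal V" "(\<alpha>, V) \<in> \<P>"
    and sol: "euler_solution {T - r powr (\<alpha> + 1)<..<T} v"
    and rep: "\<And>x t. x \<in> ball x\<^sub>0 r \<Longrightarrow> t \<in> {T - r powr (\<alpha> + 1)<..<T} \<Longrightarrow>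
           v x t = (1 / (T - t) powr (\<alpha> / (\<alpha> + 1))) *\<^sub>R
                     V ((1 / (T - t) powr (1 / (\<alpha> + 1))) *\<^sub>R (x - x\<^sub>0))"
    unfolding locally_self_similar_blowup_def by blast
  define w where "w = (\<lambda>x t. (1 / (1 - t) powr (\<alpha> / (\<alpha> + 1))) *\<^sub>R
                     V ((1 / (1 - t) powr (1 / (\<alpha> + 1))) *\<^sub>R x))"
  have "euler_solution {..<1} w"
  proof (rule euler_solution_exhaustion)
    fix R t :: real
    assume "t \<in> {..<1}"
    then have t: "t < 1" by simp
    \<comment> \<open>\<open>M = r / \<mu>\<close> is the size of the region seen after zooming in by \<open>\<mu>\<close>: it has to exceed the
      spatial radius \<open>R\<close>, and \<open>M powr (\<alpha> + 1)\<close> has to exceed the remaining time \<open>1 - t\<close>.\<close>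
    define M where "M = \<bar>R\<bar> + (1 - t) powr (1 / (\<alpha> + 1)) + 1"
    define \<mu> where "\<mu> = r / M"
    \<comment> \<open>The time factor \<open>\<mu> powr (\<alpha> + 1)\<close>, written as the product of velocity and length factors.\<close>
    let ?k = "\<mu> powr \<alpha> * \<mu>"
    let ?J = "{1 - M powr (\<alpha> + 1)<..<1}"
    let ?u = "\<lambda>x s. \<mu> powr \<alpha> *\<^sub>R v (x\<^sub>0 + \<mu> *\<^sub>R x) ((T - ?k) + ?k * s)"
    have "(1 - t) powr (1 / (\<alpha> + 1)) \<ge> 0" by simp
    then have M: "M > 0" "R < M" unfolding M_def by linarith+
    have \<mu>: "\<mu> > 0" "\<mu> * M = r" using r M by (auto simp: \<mu>_def)
    have k: "?k = \<mu> powr (\<alpha> + 1)" using \<mu> by (simp add: powr_add)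
    have kM: "?k * M powr (\<alpha> + 1) = r powr (\<alpha> + 1)"
      unfolding k using \<mu> M by (metis powr_mult less_imp_le)
    have "1 - t = ((1 - t) powr (1 / (\<alpha> + 1))) powr (\<alpha> + 1)"
      using \<alpha> t by (simp add: powr_powr)
    also have "\<dots> < M powr (\<alpha> + 1)"
      by (rule powr_less_mono2) (use \<alpha> in \<open>auto simp: M_def\<close>)
    finally have tJ: "t \<in> ?J" using t by simp
    have time: "(T - ?k) + ?k * s \<in> {T - r powr (\<alpha> + 1)<..<T}" if "s \<in> ?J" for s
    proof -
      have "?k > 0" using \<mu> by simp
      then have "?k * (1 - s) < ?k * M powr (\<alpha> + 1)" "?k * (1 - s) > 0"
        using that by (auto intro!: mult_strict_left_mono mult_pos_pos)
      then show ?thesis unfolding kM by (simp add: algebra_simps)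
    qed
    have "?u x s = w x s" if x: "x \<in> ball 0 R" and s: "s \<in> ?J" for x s
    proof -
      have "norm x < M" using x M by simp
      then have "\<mu> * norm x < r" using mult_strict_left_mono[OF _ \<mu>(1)] \<mu>(2) by metis
      then have "x\<^sub>0 + \<mu> *\<^sub>R x \<in> ball x\<^sub>0 r" using \<mu> by (simp add: dist_norm)
      moreover have "T - ((T - ?k) + ?k * s) = \<mu> powr (\<alpha> + 1) * (1 - s)"
        unfolding k[symmetric] by (simp add: algebra_simps)
      ultimately show ?thesis
        using rep[OF _ time[OF s]] self_similar_rescale[OF \<alpha> \<mu>(1), of "1 - s" V x] s
        by (simp add: w_def)
    qed
    moreover have "euler_solution ?J ?u"
      by (rule euler_solution_rescale[OF sol time])
    ultimately show "\<exists>u J. open J \<and> t \<in> J \<and> euler_solution J u \<and>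
        (\<forall>x\<in>ball 0 R. \<forall>s\<in>J. u x s = w x s)"
      using tJ by (intro exI[of _ ?u] exI[of _ ?J]) auto
  qed
  then have "self_similar_blowup \<P> w"
    unfolding self_similar_blowup_def using \<alpha> V
    by (intro exI[of _ \<alpha>] exI[of _ 1] exI[of _ V]) (auto simp: w_def)
  with assms show False by blast
qed

end
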